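(* Let $n\geq 4$, let $W$ be the Coxeter group of type $D_n$ and let $\mathbf{W}$ be its flipping group. The following are orbits of $F_2^n$ under the action of $\mathbf{W}$: $$O_i=\{a\in Z : wt(a)=i \text{ or } n-i\}\quad \text{for each } 0\leq i\leq \lfloor\tfrac{n}{2}\rfloor,$$ $$\Omega_o=\{a\in F_2^n-Z : wt(a)\equiv 1 \text{ or } n-1 \pmod 2\},$$ $$\Omega_e=\{a\in F_2^n-Z : wt(a)\equiv 0 \text{ or } n \pmod 2\}.$$ In particular $\Omega_o=\Omega_e=F_2^n-Z$ is an orbit when $n$ is odd.
   Context: The Coxeter graph of type $D_n$ has vertex set $S=\{s_1,\dots,s_n\}$ and edge set $R=\{s_is_{i+1}: 1\le i\le n-2\}\cup\{s_{n-2}s_n\}$. The Coxeter group $W$ of type $D_n$ is generated by $S$ with relations $s^2=1$, $(ss')^3=1$ if $ss'\in R$, and $(ss')^2=1$ if $s\ne s'$, $ss'\notin R$. $F_2^n$ is the space of column vectors over the two-element field $F_2$ indexed by $S$, and $\widetilde{s}$ is the characteristic vector of $s\in S$. For $s\in S$, $\mathbf{s}$ is the $n\times n$ matrix over $F_2$ acting by $\mathbf{s}\widetilde{v}=\widetilde{v}$ for $v\ne s$ and $\mathbf{s}\widetilde{s}=\widetilde{s}+\sum_{us\in R}\widetilde{u}$. The flipping group $\mathbf{W}$ is the subgroup of $\mathrm{GL}_n(F_2)$ generated by $\mathbf{s}$, $s\in S$; it acts on $F_2^n$ by left multiplication. Put $\overline{1}=\widetilde{s}_1$, $\overline{i+1}=\mathbf{s_i}\mathbf{s_{i-1}}\cdots\mathbf{s_1}\overline{1}$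 for $1\le i\le n-1$, and $\overline{n+1}=\widetilde{s}_n$; thus $\overline{i}=\widetilde{s}_{i-1}+\widetilde{s}_i$ for $2\le i\le n-2$, $\overline{n-1}=\widetilde{s}_{n-2}+\widetilde{s}_{n-1}+\widetilde{s}_n$, and $\overline{n}=\widetilde{s}_{n-1}+\widetilde{s}_n$. The set $\Delta=\{\overline{1},\dots,\overline{n-1},\overline{n+1}\}$ is a basis of $F_2^n$. For $a\in F_2^n$, $wt(a)$ is the number of elements of $\Delta$ appearing in the expression of $a$ as a linear combination of elements of $\Delta$. $Z$ is the $(n-1)$-dimensional subspace of $F_2^n$ spanned by $\overline{1},\dots,\overline{n-1}$. *)

theory Defs
  imports
    "HOL-Library.Z2"
    "HOL-Number_Theory.Cong"
    "HOL-Algebra.Generated_Groups"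
    "HOL-Algebra.Group_Action"
    "Jordan_Normal_Form.VS_Connect"
begin

text \<open>
  The vertices \<open>s\<^sub>1, \<dots>, s\<^sub>n\<close> of the Coxeter graph are represented by the numbers \<open>1, \<dots>, n\<close>,
  and the field with two elements is the type \<^typ>\<open>bit\<close>. Vector entries are indexed from \<open>0\<close>,
  so the vertex \<open>s\<close> corresponds to the entry with index \<open>s - 1\<close>.
\<close>

definition D_edges :: "nat \<Rightarrow> nat set set" where
  "D_edges n = {{i, i + 1} | i. 1 \<le> i \<and> i \<le> n - 2} \<union> {{n - 2, n}}"

definition char_vec :: "nat \<Rightarrow> nat \<Rightarrow> bit vec" where
  "char_vec n s = unit_vec n (s - 1)"

text \<open>The columns of the matrix of a vertex \<open>s\<close> are the images of the characteristic vectors.\<close>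

definition flip_mat :: "nat \<Rightarrow> nat \<Rightarrow> bit mat" where
  "flip_mat n s = mat_of_cols n
     (map (\<lambda>v. if v = s
               then char_vec n s +
                 finsum_vec TYPE(bit) n (char_vec n) {u \<in> {1..n}. {u, s} \<in> D_edges n}
               else char_vec n v)
       [1..<n + 1])"

abbreviation GL_F2 :: "nat \<Rightarrow> bit mat monoid" where
  "GL_F2 n \<equiv> units_of (ring_mat TYPE(bit) n ())"

definition flip_group :: "nat \<Rightarrow> bit mat monoid" where
  "flip_group n = (GL_F2 n)\<lparr>carrier := generate (GL_F2 n) (flip_mat n ` {1..n})\<rparr>"

definition flip_action :: "nat \<Rightarrow> bit mat \<Rightarrow> bit vec \<Rightarrow> bit vec" where
  "flip_action n g = (\<lambda>a\<in>carrier_vec n. g *\<^sub>v a)"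

text \<open>
  For \<open>1 \<le> i \<le> n\<close> the vector \<open>bar_vec n i\<close> is the product of the matrices of
  \<open>i - 1, \<dots>, 2, 1\<close>, in this order, applied to the characteristic vector of vertex \<open>1\<close>.
\<close>

definition bar_vec :: "nat \<Rightarrow> nat \<Rightarrow> bit vec" where
  "bar_vec n i =
     (if i = n + 1 then char_vec n n
      else fold (\<lambda>j a. flip_mat n j *\<^sub>v a) [1..<i] (char_vec n 1))"

definition Delta :: "nat \<Rightarrow> bit vec set" where
  "Delta n = bar_vec n ` ({1..n - 1} \<union> {n + 1})"

lemma D_edges_iff: assumes "n \<ge> 4" "s \<in> {1..n}" "u \<in> {1..n}"
  shows "{u,s} \<in> D_edges n \<longleftrightarrow> 
   (u + 1 = s \<and> s < n) \<or> (s + 1 = u \<and> u < n) \<or> (u = n - 2 \<and> s = n) \<or> (s = n - 2 \<and> u = n)"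
proof -
  have "{u,s} \<in> D_edges n \<longleftrightarrow> (\<exists>i. ((u = i \<and> s = i + 1) \<or> (u = i + 1 \<and> s = i)) \<and> 1 \<le> i \<and> i \<le> n - 2) \<or>
     (u = n - 2 \<and> s = n) \<or> (u = n \<and> s = n - 2)"
    unfolding D_edges_def Un_iff mem_Collect_eq singleton_iff doubleton_eq_iff by (rule arg_cong2[of _ _ _ _ "(\<or>)"]) blast+
  also have "(\<exists>i. ((u = i \<and> s = i + 1) \<or> (u = i + 1 \<and> s = i)) \<and> 1 \<le> i \<and> i \<le> n - 2) \<longleftrightarrow>
     (u + 1 = s \<and> 1 \<le> u \<and> u \<le> n - 2) \<or> (s + 1 = u \<and> 1 \<le> s \<and> s \<le> n - 2)"
    by metis
  finally show ?thesis using assms unfolding atLeastAtMost_iff by linarith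
qed

lemma char_vec_carrier[simp]: "char_vec n s \<in> carrier_vec n" "dim_vec (char_vec n s) = n"
  by (auto simp: char_vec_def)

lemma flip_mat_carrier[simp]: "flip_mat n s \<in> carrier_mat n n" "dim_row (flip_mat n s) = n" "dim_col (flip_mat n s) = n"
  by (auto simp: flip_mat_def mat_of_cols_def simp del: upt_Suc)

lemma flip_index: assumes "n \<ge> 4" "s \<in> {1..n}" "i < n" "j < n"
  shows "flip_mat n s $$ (i,j) = (if i = j \<or> (j + 1 = s \<and> {i+1,s} \<in> D_edges n) then 1 else 0)"
proof -
  have ns: "{s} \<notin> D_edges n" using D_edges_iff[of n s s] assms by auto
  let ?N = "{u \<in> {1..n}. {u, s} \<in> D_edges n}"
  have "finsum_vec TYPE(bit) n (char_vec n) ?N $ i = (\<Sum>u\<in>?N. char_vec n u $ i)"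
    by (rule index_finsum_vec) (use assms in auto)
  also have "\<dots> = (\<Sum>u\<in>?N. if u = i + 1 then 1 else 0)"
    by (rule sum.cong) (use assms in \<open>auto simp: char_vec_def\<close>)
  also have "\<dots> = (if {i+1,s} \<in> D_edges n then 1 else 0)"
    using assms by (subst sum.delta) auto
  finally have e: "finsum_vec TYPE(bit) n (char_vec n) ?N $ i = (if {i+1,s} \<in> D_edges n then 1 else 0)" .
  have d: "dim_vec (finsum_vec TYPE(bit) n (char_vec n) ?N) = n"
    using finsum_vec_closed[of "char_vec n" ?N n] by (simp add: Pi_def)
  have l: "[1..<n+1] ! j = Suc j" "length [1..<n+1] = n"
    using nth_upt[of 1 j "n+1"] assms(4) by (simp_all del: upt_Suc)
  have c: "char_vec n (Suc j) $ i = (if i = j then 1 else 0)"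
    using assms(3,4) by (simp add: char_vec_def)
  have "flip_mat n s $$ (i,j) = (if Suc j = s
               then char_vec n s +
                 finsum_vec TYPE(bit) n (char_vec n) ?N
               else char_vec n (Suc j)) $ i"
    unfolding flip_mat_def mat_of_cols_def using assms(3,4) l by (simp del: upt_Suc)
  also have "\<dots> = (if i = j \<or> (j + 1 = s \<and> {i+1,s} \<in> D_edges n) then 1 else 0)"
  proof (cases "Suc j = s")
    case True
    then have "(char_vec n s + finsum_vec TYPE(bit) n (char_vec n) ?N) $ i = (if i = j then 1 else 0) + (if {i+1,s} \<in> D_edges n then 1 else 0)"
      using e c d assms(3) by simp
    then show ?thesis using True ns by (cases "i = j") simp_all
  next
    case False
    then show ?thesis using c by simp
  qed
  finally show ?thesis .
qed

lemma flip_mult: assumes "n \<ge> 4" "s \<in> {1..n}" "i < n" "a \<in> carrier_vec n"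
  shows "(flip_mat n s *\<^sub>v a) $ i = a $ i + (if {i+1,s} \<in> D_edges n then a $ (s-1) else 0)"
proof -
  have ns: "{s} \<notin> D_edges n" using D_edges_iff[of n s s] assms by auto
  have "(flip_mat n s *\<^sub>v a) $ i = (\<Sum>j = 0..<n. flip_mat n s $$ (i,j) * a $ j)"
  proof -
    have "dim_vec a = n" using assms(4) by simp
    moreover have "row (flip_mat n s) i $ j = flip_mat n s $$ (i,j)" if "j < n" for j
      using that assms(3) by simp
    ultimately show ?thesis using assms(3) by (simp add: scalar_prod_def)
  qed
  also have "\<dots> = (\<Sum>j = 0..<n. (if j = i then a $ j else 0) + (if j = s - 1 then (if {i+1,s} \<in> D_edges n then a $ j else 0) else 0))"
  proof (rule sum.cong[OF refl])
    fix j assume "j \<in> {0..<n}"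
    then have j: "j < n" by simp
    show "flip_mat n s $$ (i,j) * a $ j = (if j = i then a $ j else 0) + (if j = s - 1 then (if {i+1,s} \<in> D_edges n then a $ j else 0) else 0)"
    proof (cases "j + 1 = s")
      case True
      then have "j = s - 1" by simp
      then show ?thesis using True ns flip_index[OF assms(1,2,3) j] by (cases "i = j") simp_all
    next
      case False
      then have "j \<noteq> s - 1" using assms(2) by auto
      then show ?thesis using False flip_index[OF assms(1,2,3) j] by (cases "i = j") simp_all
    qed
  qed
  also have "\<dots> = a $ i + (if {i+1,s} \<in> D_edges n then a $ (s-1) else 0)"
  proof -
    have "s - 1 < n" using assms(2) by auto
    then show ?thesis using assms(3) unfolding sum.distrib by (simp add: sum.delta)
  qed
  finally show ?thesis .
qed

lemma bar_1: "n \<ge> 4 \<Longrightarrow> bar_vec n 1 = char_vec n 1"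
  by (simp add: bar_vec_def)

lemma bar_Suc: "1 \<le> i \<Longrightarrow> i \<le> n - 1 \<Longrightarrow> bar_vec n (i + 1) = flip_mat n i *\<^sub>v bar_vec n i"
proof -
  assume "1 \<le> i" "i \<le> n - 1"
  then have "i + 1 \<noteq> n + 1" "i \<noteq> n + 1" "[1..<i + 1] = [1..<i] @ [i]" by auto
  then show ?thesis unfolding bar_vec_def by (simp del: upt_Suc)
qed

lemma bar_carrier: assumes "n \<ge> 4" "i \<ge> 1" "i \<le> n + 1" shows "bar_vec n i \<in> carrier_vec n"
proof (cases "i = n + 1")
  case False
  have "i \<le> n \<longrightarrow> bar_vec n i \<in> carrier_vec n" using assms(2)
  proof (induct i rule: dec_induct)
    case base show ?case using bar_1 assms by auto
  next
    case (step m)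
    show ?case
    proof
      assume "Suc m \<le> n"
      then have "bar_vec n (Suc m) = flip_mat n m *\<^sub>v bar_vec n m" "bar_vec n m \<in> carrier_vec n"
        using bar_Suc[of m n] step by simp_all
      then show "bar_vec n (Suc m) \<in> carrier_vec n"
        using mult_mat_vec_carrier[OF flip_mat_carrier(1)] by simp
    qed
  qed
  then show ?thesis using False assms by auto
qed (auto simp: bar_vec_def)

lemma char_index: "1 \<le> v \<Longrightarrow> i < n \<Longrightarrow> v \<le> n \<Longrightarrow> char_vec n v $ i = (if i + 1 = v then 1 else 0)"
  unfolding char_vec_def by (cases v) simp_all

lemma flip_other: assumes "n \<ge> 4" "s \<in> {1..n}" "v \<in> {1..n}" "v \<noteq> s"
  shows "flip_mat n s *\<^sub>v char_vec n v = char_vec n v"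
proof (rule eq_vecI)
  fix i assume "i < dim_vec (char_vec n v)"
  then have i: "i < n" by simp
  have "char_vec n v $ (s - 1) = 0" using assms by (subst char_index) auto
  then show "(flip_mat n s *\<^sub>v char_vec n v) $ i = char_vec n v $ i"
    using flip_mult[OF assms(1,2) i, of "char_vec n v"] by simp
qed simp

lemma flip_self: assumes "n \<ge> 4" "s \<in> {1..n}" "i < n"
  shows "(flip_mat n s *\<^sub>v char_vec n s) $ i = (if i + 1 = s then 1 else 0) + (if {i+1,s} \<in> D_edges n then 1 else 0)"
proof -
  have s: "1 \<le> s" "s \<le> n" "s - 1 < n" "s - 1 + 1 = s" using assms(2) by auto
  have "char_vec n s $ (s - 1) = 1" using s by (subst char_index) simp_all
  moreover have "char_vec n s $ i = (if i + 1 = s then 1 else 0)" by (rule char_index) (use s assms in auto)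
  ultimately show ?thesis using flip_mult[OF assms(1,2,3), of "char_vec n s"] by simp
qed

lemma flip_first: assumes "n \<ge> 4"
  shows "flip_mat n 1 *\<^sub>v char_vec n 1 = char_vec n 1 + char_vec n 2"
proof (rule eq_vecI)
  fix i assume "i < dim_vec (char_vec n 1 + char_vec n 2)"
  then have i: "i < n" by simp
  have "{i+1,1} \<in> D_edges n \<longleftrightarrow> i + 1 = 2"
    by (subst D_edges_iff) (use i assms in auto)
  then show "(flip_mat n 1 *\<^sub>v char_vec n 1) $ i = (char_vec n 1 + char_vec n 2) $ i"
    using flip_self[of n 1 i] i assms char_index[of 1 i n] char_index[of 2 i n] by simp
qed simp

lemma flip_mid: assumes "n \<ge> 4" "2 \<le> m" "m \<le> n - 3"
  shows "flip_mat n m *\<^sub>v char_vec n m = char_vec n (m - 1) + (char_vec n m + char_vec n (m + 1))"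
proof (rule eq_vecI)
  fix i assume "i < dim_vec (char_vec n (m - 1) + (char_vec n m + char_vec n (m + 1)))"
  then have i: "i < n" by simp
  have "{i+1,m} \<in> D_edges n \<longleftrightarrow> i + 1 = m - 1 \<or> i + 1 = m + 1"
    by (subst D_edges_iff) (use i assms in auto)
  moreover have "\<not> (i + 1 = m - 1 \<and> i + 1 = m + 1)" by arith
  ultimately have e: "(if {i+1,m} \<in> D_edges n then 1 else (0::bit)) = (if i + 1 = m - 1 then 1 else 0) + (if i + 1 = m + 1 then 1 else 0)"
    by (cases "i + 1 = m - 1"; cases "i + 1 = m + 1") simp_all
  have "m \<in> {1..n}" "1 \<le> m - 1" "m - 1 \<le> n" "1 \<le> m" "m \<le> n" "m + 1 \<le> n" using assms by auto
  then show "(flip_mat n m *\<^sub>v char_vec n m) $ i = (char_vec n (m - 1) + (char_vec n m + char_vec n (m + 1))) $ i"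
    using flip_self[of n m i, unfolded e] i assms(1) char_index[of "m - 1" i n] char_index[of m i n] char_index[of "m + 1" i n]
    by (simp add: ac_simps del: bit_not_zero_iff bit_not_one_iff)
qed simp

lemma flip_branch: assumes "n \<ge> 4"
  shows "flip_mat n (n - 2) *\<^sub>v char_vec n (n - 2) = char_vec n (n - 3) + (char_vec n (n - 2) + char_vec n (n - 1) + char_vec n n)"
proof (rule eq_vecI)
  fix i assume "i < dim_vec (char_vec n (n - 3) + (char_vec n (n - 2) + char_vec n (n - 1) + char_vec n n))"
  then have i: "i < n" by simp
  have "{i+1,n-2} \<in> D_edges n \<longleftrightarrow> i + 1 = n - 3 \<or> i + 1 = n - 1 \<or> i + 1 = n"
    by (subst D_edges_iff) (use i assms in auto)
  moreover have "\<not> (i + 1 = n - 3 \<and> i + 1 = n - 1)" "\<not> (i + 1 = n - 3 \<and> i + 1 = n)" "\<not> (i + 1 = n - 1 \<and> i + 1 = n)"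
    using assms by arith+
  ultimately have e: "(if {i+1,n-2} \<in> D_edges n then 1 else (0::bit)) = (if i + 1 = n - 3 then 1 else 0) + ((if i + 1 = n - 1 then 1 else 0) + (if i + 1 = n then 1 else 0))"
    by (cases "i + 1 = n - 3"; cases "i + 1 = n - 1"; cases "i + 1 = n") simp_all
  have r: "n - 2 \<in> {1..n}" "1 \<le> n - 3" "n - 3 \<le> n" "1 \<le> n - 2" "n - 2 \<le> n" "1 \<le> n - 1" "n - 1 \<le> n" "1 \<le> n" "n \<le> n"
    using assms by auto
  show "(flip_mat n (n - 2) *\<^sub>v char_vec n (n - 2)) $ i = (char_vec n (n - 3) + (char_vec n (n - 2) + char_vec n (n - 1) + char_vec n n)) $ i"
    unfolding flip_self[OF assms r(1) i] e
    using i char_index[OF r(2) i r(3)] char_index[OF r(4) i r(5)] char_index[OF r(6) i r(7)] char_index[OF r(8) i r(9)]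
    by (simp only: index_add_vec char_vec_carrier ac_simps)
qed simp

lemma vsum_cancel: fixes x y :: "bit vec" assumes "x \<in> carrier_vec n" "y \<in> carrier_vec n"
  shows "x + (x + y) = y"
  by (rule eq_vecI) (use assms in \<open>auto simp flip: add.assoc\<close>)

lemma bar_mid: assumes "n \<ge> 4" "2 \<le> i"
  shows "i \<le> n - 2 \<longrightarrow> bar_vec n i = char_vec n (i - 1) + char_vec n i"
  using assms(2)
proof (induct i rule: dec_induct)
  case base
  have "bar_vec n (1 + 1) = flip_mat n 1 *\<^sub>v bar_vec n 1"
    by (rule bar_Suc) (use assms in auto)
  then show ?case unfolding bar_1[OF assms(1)] flip_first[OF assms(1)] one_add_one by simp
next
  case (step m)
  show ?case
  proof
    assume le: "Suc m \<le> n - 2"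
    have b: "bar_vec n m = char_vec n (m - 1) + char_vec n m" using step le by simp
    have "bar_vec n (m + 1) = flip_mat n m *\<^sub>v bar_vec n m"
      by (rule bar_Suc) (use step le in auto)
    also have "\<dots> = flip_mat n m *\<^sub>v char_vec n (m - 1) + flip_mat n m *\<^sub>v char_vec n m"
      unfolding b by (rule mult_add_distrib_mat_vec[of _ n n]) simp_all
    also have "flip_mat n m *\<^sub>v char_vec n (m - 1) = char_vec n (m - 1)"
      by (rule flip_other) (use assms step le in auto)
    also have "flip_mat n m *\<^sub>v char_vec n m = char_vec n (m - 1) + (char_vec n m + char_vec n (m + 1))"
      by (rule flip_mid) (use assms step le in auto)
    also have "char_vec n (m - 1) + \<dots> = char_vec n m + char_vec n (m + 1)"
      by (rule vsum_cancel[of _ n]) simp_all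
    finally show "bar_vec n (Suc m) = char_vec n (Suc m - 1) + char_vec n (Suc m)" by simp
  qed
qed

lemma bar_n1: assumes "n \<ge> 4"
  shows "bar_vec n (n - 1) = char_vec n (n - 2) + char_vec n (n - 1) + char_vec n n"
proof -
  have e: "n - 2 + 1 = n - 1" "n - 2 - 1 = n - 3" using assms by auto
  have b: "bar_vec n (n - 2) = char_vec n (n - 3) + char_vec n (n - 2)"
    using bar_mid[of n "n - 2"] assms e by simp
  have "bar_vec n (n - 2 + 1) = flip_mat n (n - 2) *\<^sub>v bar_vec n (n - 2)"
    by (rule bar_Suc) (use assms in auto)
  also have "\<dots> = flip_mat n (n - 2) *\<^sub>v char_vec n (n - 3) + flip_mat n (n - 2) *\<^sub>v char_vec n (n - 2)"
    unfolding b by (rule mult_add_distrib_mat_vec[of _ n n]) simp_all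
  also have "flip_mat n (n - 2) *\<^sub>v char_vec n (n - 3) = char_vec n (n - 3)"
    by (rule flip_other) (use assms in auto)
  also note flip_branch[OF assms]
  also have "char_vec n (n - 3) + (char_vec n (n - 3) + (char_vec n (n - 2) + char_vec n (n - 1) + char_vec n n)) = char_vec n (n - 2) + char_vec n (n - 1) + char_vec n n"
    by (rule vsum_cancel[of _ n]) simp_all
  finally show ?thesis unfolding e .
qed

lemma Delta_basis: assumes n: "n \<ge> 4"
  shows "vectorspace.basis class_ring (module_vec TYPE(bit) n) (Delta n)"
proof -
  interpret vec_space "TYPE(bit)" n .
  have car: "Delta n \<subseteq> carrier_vec n" using bar_carrier n by (auto simp: Delta_def)
  have fin: "finite (Delta n)" by (auto simp: Delta_def)
  have cd: "card (Delta n) \<le> n"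
  proof -
    have "card (Delta n) \<le> card ({1..n - 1} \<union> {n + 1})" unfolding Delta_def by (rule card_image_le) auto
    also have "\<dots> = n" using n by (subst card_Un_disjoint) auto
    finally show ?thesis .
  qed
  define S where "S = span (Delta n)"
  have incl: "x \<in> S" if "x \<in> Delta n" for x
    unfolding S_def using that car in_own_span by blast
  have add: "x + y \<in> S" if "x \<in> S" "y \<in> S" for x y
    using that unfolding S_def by (rule span_add1[OF car])
  have D: "bar_vec n i \<in> S" if "1 \<le> i" "i \<le> n - 1" for i
    using that by (intro incl) (auto simp: Delta_def)
  have cn: "char_vec n n \<in> S"
    by (rule incl) (auto simp: Delta_def bar_vec_def intro!: image_eqI[of _ _ "n+1"])
  have low: "i \<le> n - 2 \<longrightarrow> char_vec n i \<in> S" if "1 \<le> i" for i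
    using that
  proof (induct i rule: dec_induct)
    case base
    have "bar_vec n 1 \<in> S" by (rule D) (use n in auto)
    then show ?case unfolding bar_1[OF n] by blast
  next
    case (step m)
    show ?case
    proof
      assume "Suc m \<le> n - 2"
      then have "char_vec n m + bar_vec n (Suc m) \<in> S"
        using step D[of "Suc m"] by (intro add) auto
      also have "char_vec n m + bar_vec n (Suc m) = char_vec n (Suc m)"
        using bar_mid[of n "Suc m"] step(1) n \<open>Suc m \<le> n - 2\<close> vsum_cancel[of "char_vec n m" n "char_vec n (Suc m)"] by simp
      finally show "char_vec n (Suc m) \<in> S" .
    qed
  qed
  have "char_vec n n + (char_vec n (n - 2) + bar_vec n (n - 1)) \<in> S"
    using low[of "n - 2"] cn D[of "n - 1"] n by (intro add) auto
  also have "char_vec n n + (char_vec n (n - 2) + bar_vec n (n - 1)) = char_vec n (n - 1)"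
    unfolding bar_n1[OF n] by (rule eq_vecI) (use n in \<open>auto simp: char_vec_def\<close>)
  finally have cn1: "char_vec n (n - 1) \<in> S" .
  have all: "char_vec n i \<in> S" if i: "1 \<le> i" "i \<le> n" for i
  proof -
    consider "i \<le> n - 2" | "i = n - 1" | "i = n" using i by linarith
    then show ?thesis
    proof cases
      case 1 then show ?thesis using low[OF i(1)] by blast
    qed (use cn cn1 in blast)+
  qed
  have "set (unit_vecs n) \<subseteq> S"
  proof
    fix x :: "bit vec" assume "x \<in> set (unit_vecs n)"
    then obtain i where i: "i < n" "x = unit_vec n i" unfolding unit_vecs_def by auto
    then have "x = char_vec n (Suc i)" by (simp add: char_vec_def)
    then show "x \<in> S" using all[of "Suc i"] i(1) by simp
  qed
  then have "span (set (unit_vecs n)) \<subseteq> span (Delta n)"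
    unfolding S_def by (rule span_subsetI[OF car])
  then have "carrier_vec n \<subseteq> span (Delta n)"
    using span_unit_vecs_is_carrier by (rule back_subst[of "\<lambda>X. X \<subseteq> _"])
  with span_is_subset2[OF car] have gen: "span (Delta n) = carrier_vec n"
    by (rule equalityI)
  show ?thesis
    by (rule dim_gen_is_basis[OF fin car gen]) (use cd dim_is_n in simp)
qed

lemma Delta_coeffs_unique: assumes n: "n \<ge> 4" and a: "a \<in> carrier_vec n"
  shows "\<exists>!c. c \<in> Delta n \<rightarrow>\<^sub>E UNIV \<and>
             a = LinearCombinations.module.lincomb (module_vec TYPE(bit) n) c (Delta n)"
proof -
  interpret vec_space "TYPE(bit)" n .
  have car: "Delta n \<subseteq> carrier_vec n" using bar_carrier n by (auto simp: Delta_def)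
  have fin: "finite (Delta n)" by (auto simp: Delta_def)
  have "\<forall>v. v \<in> carrier_vec n \<longrightarrow> (\<exists>!c. c \<in> Delta n \<rightarrow>\<^sub>E UNIV \<and> lincomb c (Delta n) = v)"
    by (rule iffD1[OF basis_criterion[OF fin car] Delta_basis[OF n]])
  from this[rule_format, OF a] show ?thesis
    unfolding eq_commute[of a] .
qed

definition Z :: "nat \<Rightarrow> bit vec set" where
  "Z n = LinearCombinations.module.span class_ring (module_vec TYPE(bit) n) (bar_vec n ` {1..n - 1})"

text \<open>
  By \<open>Delta_coeffs_unique\<close>, the coefficients of a vector are unique once the coefficient
  function is fixed to be \<open>undefined\<close> outside \<open>Delta n\<close>.
\<close>

definition Delta_coeffs :: "nat \<Rightarrow> bit vec \<Rightarrow> bit vec \<Rightarrow> bit" where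
  "Delta_coeffs n a =
     (THE c. c \<in> Delta n \<rightarrow>\<^sub>E UNIV \<and>
             a = LinearCombinations.module.lincomb (module_vec TYPE(bit) n) c (Delta n))"

definition wt :: "nat \<Rightarrow> bit vec \<Rightarrow> nat" where
  "wt n a = card {d \<in> Delta n. Delta_coeffs n a d \<noteq> 0}"

definition O_set :: "nat \<Rightarrow> nat \<Rightarrow> bit vec set" where
  "O_set n i = {a \<in> Z n. wt n a = i \<or> wt n a = n - i}"

definition Omega_o :: "nat \<Rightarrow> bit vec set" where
  "Omega_o n = {a \<in> carrier_vec n - Z n. [wt n a = 1] (mod 2) \<or> [wt n a = n - 1] (mod 2)}"

definition Omega_e :: "nat \<Rightarrow> bit vec set" where
  "Omega_e n = {a \<in> carrier_vec n - Z n. [wt n a = 0] (mod 2) \<or> [wt n a = n] (mod 2)}"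

end

theory Submission
  imports Defs "HOL-Combinatorics.Transposition"
begin

text \<open>
  Write \<open>b\<^sub>i\<close> for \<open>bar_vec n i\<close>. The vectors \<open>b\<^sub>1, \<dots>, b\<^sub>n\<close> span \<open>Z\<close> with the single relation
  \<open>b\<^sub>1 + \<dots> + b\<^sub>n = 0\<close>, so a vector of \<open>Z\<close> is a subset of \<open>{1..n}\<close> up to complement. The generator of a
  vertex \<open>s < n\<close> acts as the transposition of \<open>s\<close> and \<open>s + 1\<close>, and on \<open>Z\<close> the last generator acts as that
  of vertex \<open>n - 1\<close>. Hence the orbits in \<open>Z\<close> are given by the size of the subset, up to complement.
  Outside \<open>Z\<close> a vector is \<open>b\<^sub>n\<^sub>+\<^sub>1\<close> plus a vector of \<open>Z\<close>; the last generator now also adds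
  \<open>b\<^sub>n\<^sub>-\<^sub>1 + b\<^sub>n\<close>, so exactly the parity of the size of the subset survives, and for odd \<open>n\<close> not even that,
  since complements have opposite parity.
\<close>

subsection \<open>Sums of the vectors \<open>bar_vec\<close>\<close>

text \<open>The only neighbour of vertex \<open>n - 1\<close> is \<open>n - 2\<close>, and
  \<open>bar_vec n (n - 1)\<close> has entry 1 at vertex \<open>n - 1\<close>, so the flip cancels
  its summand \<open>char_vec n (n - 2)\<close>.\<close>

lemma bar_last:
  assumes "n \<ge> 4"
  shows "bar_vec n n = char_vec n (n - 1) + char_vec n n"
proof -
  have "bar_vec n n = flip_mat n (n - 1) *\<^sub>v bar_vec n (n - 1)"
    using bar_Suc[of "n - 1" n] assms by simp
  also have "\<dots> = char_vec n (n - 1) + char_vec n n"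
  proof (rule eq_vecI)
    fix k assume "k < dim_vec (char_vec n (n - 1) + char_vec n n)"
    then have k: "k < n" by simp
    have s: "n - 1 \<in> {1..n}" "n - 1 - 1 < n" using assms by auto
    have edge: "{k + 1, n - 1} \<in> D_edges n \<longleftrightarrow> k + 1 = n - 2"
      by (subst D_edges_iff) (use assms k in auto)
    have "(flip_mat n (n - 1) *\<^sub>v bar_vec n (n - 1)) $ k =
        bar_vec n (n - 1) $ k + (if k + 1 = n - 2 then bar_vec n (n - 1) $ (n - 1 - 1) else 0)"
      using flip_mult[OF assms s(1) k bar_carrier[of n "n - 1"]] assms unfolding edge by simp
    also have "\<dots> = (char_vec n (n - 1) + char_vec n n) $ k"
    proof -
      obtain m where "n = m + 4" using assms by (metis add.commute le_Suc_ex)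
      then show ?thesis
        unfolding bar_n1[OF assms] using k by (simp add: char_vec_def del: add_bit_eq_xor)
    qed
    finally show "(flip_mat n (n - 1) *\<^sub>v bar_vec n (n - 1)) $ k =
      (char_vec n (n - 1) + char_vec n n) $ k" .
  qed simp
  finally show ?thesis .
qed

text \<open>Entry \<open>k\<close> belongs to vertex \<open>k + 1\<close>. The support consists of
  the vertices \<open>i - 1\<close> and \<open>i\<close> as far as they exist; the last disjunct is
  the extra vertex \<open>n\<close> of \<open>bar_vec n (n - 1)\<close>, caused by the branching of
  the graph.\<close>

lemma bar_index:
  assumes "n \<ge> 4" "1 \<le> i" "i \<le> n" "k < n"
  shows "bar_vec n i $ k = of_bool (i = k + 1 \<or> i = k + 2 \<or> k = n - 1 \<and> i = n - 1)"
proof -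
  consider "i = 1" | "2 \<le> i" "i \<le> n - 2" | "i = n - 1" | "i = n" using assms by linarith
  then show ?thesis
  proof cases
    case 1
    then show ?thesis using assms by (auto simp: bar_1 char_vec_def simp flip: One_nat_def)
  next
    case 2
    then show ?thesis using assms bar_mid[of n i] by (auto simp: char_vec_def)
  next
    case 3
    obtain m where "n = m + 4" using assms(1) by (metis add.commute le_Suc_ex)
    then show ?thesis using 3 assms bar_n1[of n] by (auto simp: char_vec_def)
  next
    case 4
    then show ?thesis using assms bar_last[of n] by (auto simp: char_vec_def)
  qed
qed

text \<open>Over the two-element field every linear combination is the sum over its support.
  Indexing by numbers instead of vectors lets permutations act on the index set, and the entrywise
  form reduces everything to sums in the field.\<close>

definition bar_sum :: "nat \<Rightarrow> nat set \<Rightarrow> bit vec" where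
  "bar_sum n I = vec n (\<lambda>k. \<Sum>i\<in>I. bar_vec n i $ k)"

lemma bar_sum_carrier [simp]: "bar_sum n I \<in> carrier_vec n" "dim_vec (bar_sum n I) = n"
  by (simp_all add: bar_sum_def)

lemma bar_sum_index: "k < n \<Longrightarrow> bar_sum n I $ k = (\<Sum>i\<in>I. bar_vec n i $ k)"
  by (simp add: bar_sum_def)

text \<open>As \<open>s\<close> is not adjacent to itself, the flip keeps the entry at
  \<open>s\<close>; a second flip adds the same vector again, which cancels in characteristic
  2.\<close>

lemma flip_mat_involutive:
  assumes "n \<ge> 4" "s \<in> {1..n}"
  shows "flip_mat n s * flip_mat n s = 1\<^sub>m n"
proof (rule eq_matI)
  fix i j assume "i < dim_row (1\<^sub>m n :: bit mat)" "j < dim_col (1\<^sub>m n :: bit mat)"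
  then have ij: "i < n" "j < n" by simp_all
  have c: "col (flip_mat n s) j \<in> carrier_vec n" using ij by (simp add: carrier_vecI)
  have s: "s - 1 < n" using assms by auto
  have "{s} \<notin> D_edges n" using D_edges_iff[of n s s] assms by auto
  moreover have "(flip_mat n s * flip_mat n s) $$ (i,j) = (flip_mat n s *\<^sub>v col (flip_mat n s) j) $ i"
    using ij by simp
  moreover have "\<dots> = flip_mat n s $$ (i,j) + (if {i+1,s} \<in> D_edges n then flip_mat n s $$ (s-1,j) else 0)"
    using flip_mult[OF assms ij(1) c] ij s by simp
  ultimately show "(flip_mat n s * flip_mat n s) $$ (i,j) = 1\<^sub>m n $$ (i,j)"
    using flip_index[OF assms ij] flip_index[OF assms s ij(2)] ij assms by auto
qed simp_all

lemma flip_mult_flip: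
  assumes "n \<ge> 4" "s \<in> {1..n}" "a \<in> carrier_vec n"
  shows "flip_mat n s *\<^sub>v (flip_mat n s *\<^sub>v a) = a"
  using assoc_mult_mat_vec[of "flip_mat n s" n n "flip_mat n s" n a] flip_mat_involutive assms
  by simp

text \<open>A flip at \<open>s\<close> changes only vectors with a nonzero entry at
  \<open>s\<close>. For \<open>s < n\<close> these are \<open>bar_vec n s\<close> and
  \<open>bar_vec n (s + 1)\<close>, which are exchanged by the recursion for \<open>bar_vec\<close>
  and by involutivity.\<close>

lemma flip_bar:
  assumes n: "n \<ge> 4" and s: "1 \<le> s" "s < n" and i: "1 \<le> i" "i \<le> n + 1"
  shows "flip_mat n s *\<^sub>v bar_vec n i = bar_vec n (transpose s (s + 1) i)"
proof -
  have sn: "s \<in> {1..n}" "s - 1 < n" using s by auto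
  consider "i = s" | "i = s + 1" | "i = n + 1" "i \<noteq> s + 1" | "i \<le> n" "i \<noteq> s" "i \<noteq> s + 1" using i by linarith
  then show ?thesis
  proof cases
    case 1
    then show ?thesis using bar_Suc[of s n] s by simp
  next
    case 2
    then show ?thesis
      using bar_Suc[of s n] s flip_mult_flip[OF n sn(1)] bar_carrier[OF n, of s] by simp
  next
    case 3
    then show ?thesis
      using s n flip_other[of n s n] by (auto simp: bar_vec_def transpose_def)
  next
    case 4
    have "flip_mat n s *\<^sub>v bar_vec n i = bar_vec n i"
    proof (rule eq_vecI)
      fix k assume "k < dim_vec (bar_vec n i)"
      then have "k < n" using bar_carrier[OF n i] by simp
      moreover have "bar_vec n i $ (s - 1) = 0"
        using bar_index[OF n i(1) 4(1) sn(2)] 4 s by auto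
      ultimately show "(flip_mat n s *\<^sub>v bar_vec n i) $ k = bar_vec n i $ k"
        using flip_mult[OF n sn(1) _ bar_carrier[OF n i]] by simp
    qed (use bar_carrier[OF n i] in auto)
    then show ?thesis using 4 by simp
  qed
qed

lemma flip_bar_sum_index:
  assumes "n \<ge> 4" "s \<in> {1..n}" "I \<subseteq> {1..n + 1}" "k < n"
  shows "(flip_mat n s *\<^sub>v bar_sum n I) $ k = (\<Sum>i\<in>I. (flip_mat n s *\<^sub>v bar_vec n i) $ k)"
proof -
  have s: "s - 1 < n" using assms by auto
  have "(\<Sum>i\<in>I. (flip_mat n s *\<^sub>v bar_vec n i) $ k) =
      (\<Sum>i\<in>I. bar_vec n i $ k + (if {k+1,s} \<in> D_edges n then bar_vec n i $ (s-1) else 0))"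
    by (intro sum.cong refl flip_mult[OF assms(1,2,4)] bar_carrier[OF assms(1)]) (use assms(3) in auto)
  then show ?thesis
    using assms(4) s flip_mult[OF assms(1,2,4), of "bar_sum n I"]
    by (simp add: bar_sum_index sum.distrib del: add_bit_eq_xor)
qed

lemma flip_bar_sum:
  assumes n: "n \<ge> 4" and s: "1 \<le> s" "s < n" and I: "I \<subseteq> {1..n + 1}"
  shows "flip_mat n s *\<^sub>v bar_sum n I = bar_sum n (transpose s (s + 1) ` I)"
proof (rule eq_vecI)
  fix k assume "k < dim_vec (bar_sum n (transpose s (s + 1) ` I))"
  then have k: "k < n" by simp
  have "(flip_mat n s *\<^sub>v bar_sum n I) $ k = (\<Sum>i\<in>I. (flip_mat n s *\<^sub>v bar_vec n i) $ k)"
    by (rule flip_bar_sum_index) (use assms k in auto)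
  also have "\<dots> = (\<Sum>i\<in>I. bar_vec n (transpose s (s + 1) i) $ k)"
    by (intro sum.cong refl arg_cong[where f = "\<lambda>v. v $ k"] flip_bar) (use assms in auto)
  also have "\<dots> = (\<Sum>i\<in>transpose s (s + 1) ` I. bar_vec n i $ k)"
    by (subst sum.reindex) auto
  finally show "(flip_mat n s *\<^sub>v bar_sum n I) $ k = bar_sum n (transpose s (s + 1) ` I) $ k"
    using k by (simp add: bar_sum_index)
qed simp

text \<open>The common part occurs twice on the right and cancels.\<close>

lemma sum_bit_sym_diff:
  fixes f :: "'a \<Rightarrow> bit"
  assumes "finite I" "finite J"
  shows "sum f (sym_diff I J) = sum f I + sum f J"
proof -
  have "sum f (sym_diff I J) = sum f (I - J) + sum f (J - I)"
    using assms by (intro sum.union_disjoint) auto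
  moreover have "sum f I = sum f (I \<inter> J) + sum f (I - J)" "sum f J = sum f (I \<inter> J) + sum f (J - I)"
    using sum.Int_Diff[of I f J] sum.Int_Diff[of J f I] assms by (simp_all add: Int_commute)
  ultimately show ?thesis
    by (cases "sum f (I \<inter> J)"; cases "sum f (I - J)"; cases "sum f (J - I)") simp_all
qed

lemma bar_sum_sym_diff:
  assumes "finite I" "finite J"
  shows "bar_sum n (sym_diff I J) = bar_sum n I + bar_sum n J"
  using assms by (intro eq_vecI) (simp_all add: bar_sum_index sum_bit_sym_diff del: add_bit_eq_xor)

text \<open>Each entry equals 1 for exactly two of the summands. In entry \<open>n - 1\<close> the
  index \<open>k + 2\<close> would leave the range, and the exceptional index \<open>n - 1\<close>
  takes its place.\<close>

lemma bar_sum_all: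
  assumes "n \<ge> 4"
  shows "bar_sum n {1..n} = 0\<^sub>v n"
proof (rule eq_vecI)
  fix k assume "k < dim_vec (0\<^sub>v n :: bit vec)"
  then have k: "k < n" by simp
  define J where "J = (if k = n - 1 then {n - 1, n} else {k + 1, k + 2})"
  have "(\<Sum>i\<in>{1..n}. bar_vec n i $ k) = (\<Sum>i\<in>J. 1)"
    using k assms by (intro sum.mono_neutral_cong_right) (auto simp: J_def bar_index split: if_splits)
  also have "\<dots> = 0" using assms by (auto simp: J_def)
  finally show "bar_sum n {1..n} $ k = 0\<^sub>v n $ k" using k by (simp add: bar_sum_index)
qed simp

lemma bar_sum_compl:
  assumes "n \<ge> 4" "I \<subseteq> {1..n}"
  shows "bar_sum n ({1..n} - I) = bar_sum n I"
proof -
  have "{1..n} - I = sym_diff {1..n} I" using assms by auto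
  then show ?thesis
    using bar_sum_sym_diff[of "{1..n}" I n] finite_subset[OF assms(2)]
    unfolding bar_sum_all[OF assms(1)] by simp
qed

section \<open>The generator of vertex \<open>n\<close>\<close>

lemma bar_sum_insert:
  assumes "n \<ge> 4" "I \<subseteq> {1..n}"
  shows "bar_sum n (insert (n + 1) I) = bar_sum n I + char_vec n n"
proof -
  have "finite I" "n + 1 \<notin> I" using assms finite_subset by auto
  then show ?thesis
    by (intro eq_vecI) (auto simp: bar_sum_index bar_vec_def add.commute simp del: add_bit_eq_xor)
qed

text \<open>Vertex \<open>n - 2\<close> is the only neighbour of \<open>n\<close>, so this is the
  vector that the last generator adds, rewritten so that its effect on index sets is
  visible.\<close>

lemma char_vec_branch:
  assumes "n \<ge> 4"
  shows "char_vec n (n - 2) = bar_sum n {n - 1, n}"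
proof -
  obtain m where "n = m + 4" using assms by (metis add.commute le_Suc_ex)
  then show ?thesis
    by (intro eq_vecI) (auto simp: bar_sum_index bar_index char_vec_def)
qed

text \<open>The vertices \<open>n - 1\<close> and \<open>n\<close> have the same neighbours, and
  each of \<open>bar_vec n 1\<close>, ..., \<open>bar_vec n n\<close> has equal entries at these two
  vertices. On their sums the two generators therefore agree.\<close>

lemma flip_last_bar_sum:
  assumes n: "n \<ge> 4" and I: "I \<subseteq> {1..n}"
  shows "flip_mat n n *\<^sub>v bar_sum n I = bar_sum n (transpose (n - 1) n ` I)"
proof -
  have "bar_sum n I $ (n - 2) = bar_sum n I $ (n - 1)"
  proof -
    have "bar_vec n i $ (n - 2) = bar_vec n i $ (n - 1)" if "i \<in> I" for i
    proof -
      have "1 \<le> i" "i \<le> n" using that I by auto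
      then show ?thesis
        using n bar_index[OF n, of i "n - 2"] bar_index[OF n, of i "n - 1"] by auto
    qed
    then show ?thesis using n by (auto simp: bar_sum_index intro!: sum.cong)
  qed
  then have "flip_mat n n *\<^sub>v bar_sum n I = flip_mat n (n - 1) *\<^sub>v bar_sum n I"
  proof (intro eq_vecI)
    fix k assume eq: "bar_sum n I $ (n - 2) = bar_sum n I $ (n - 1)"
      and "k < dim_vec (flip_mat n (n - 1) *\<^sub>v bar_sum n I)"
    then have k: "k < n" by simp
    have r: "n \<in> {1..n}" "n - 1 \<in> {1..n}" using n by auto
    have "{k+1, n} \<in> D_edges n \<longleftrightarrow> {k+1, n-1} \<in> D_edges n"
      by (subst (1 2) D_edges_iff) (use n k in auto)
    then show "(flip_mat n n *\<^sub>v bar_sum n I) $ k = (flip_mat n (n - 1) *\<^sub>v bar_sum n I) $ k"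
      using flip_mult[OF n r(1) k, of "bar_sum n I"] flip_mult[OF n r(2) k, of "bar_sum n I"] eq
      by (simp add: numeral_2_eq_2)
  qed simp
  also have "\<dots> = bar_sum n (transpose (n - 1) n ` I)"
  proof -
    have "1 \<le> n - 1" "n - 1 < n" "I \<subseteq> {1..n + 1}" "n - 1 + 1 = n" using n I by auto
    then show ?thesis using flip_bar_sum[OF n, of "n - 1" I] by metis
  qed
  finally show ?thesis .
qed

text \<open>The summand \<open>char_vec n n\<close> now contributes an additional
  \<open>char_vec n (n - 2)\<close>, which toggles the membership of \<open>n - 1\<close> and
  \<open>n\<close>.\<close>

lemma flip_last_bar_sum_insert:
  assumes n: "n \<ge> 4" and I: "I \<subseteq> {1..n}"
  shows "flip_mat n n *\<^sub>v bar_sum n (insert (n + 1) I) =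
    bar_sum n (insert (n + 1) (sym_diff (transpose (n - 1) n ` I) {n - 1, n}))"
proof -
  let ?J = "transpose (n - 1) n ` I"
  have J: "?J \<subseteq> {1..n}" "finite ?J"
    using I n finite_subset[OF I] by (auto simp: transpose_def)
  have last: "flip_mat n n *\<^sub>v char_vec n n = char_vec n (n - 2) + char_vec n n"
  proof (rule eq_vecI)
    fix k assume "k < dim_vec (char_vec n (n - 2) + char_vec n n)"
    then have k: "k < n" by simp
    have "{k+1, n} \<in> D_edges n \<longleftrightarrow> k + 1 = n - 2"
      by (subst D_edges_iff) (use n k in auto)
    then show "(flip_mat n n *\<^sub>v char_vec n n) $ k = (char_vec n (n - 2) + char_vec n n) $ k"
      using flip_self[of n n k] n k by (auto simp: char_index)
  qed simp
  have "flip_mat n n *\<^sub>v bar_sum n (insert (n + 1) I) =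
      flip_mat n n *\<^sub>v bar_sum n I + flip_mat n n *\<^sub>v char_vec n n"
    unfolding bar_sum_insert[OF n I] by (rule mult_add_distrib_mat_vec[of _ n n]) simp_all
  also have "\<dots> = bar_sum n (sym_diff ?J {n - 1, n}) + char_vec n n"
    using J unfolding flip_last_bar_sum[OF n I] last char_vec_branch[OF n]
    by (subst bar_sum_sym_diff) (auto simp: assoc_add_vec[of _ n])
  also have "\<dots> = bar_sum n (insert (n + 1) (sym_diff ?J {n - 1, n}))"
    by (rule bar_sum_insert[OF n, symmetric]) (use J n in auto)
  finally show ?thesis .
qed

subsection \<open>Orbits as reachability classes\<close>

text \<open>Each generator is its own inverse, so chains of such steps trace out the full orbits of
  the group.\<close>

definition flip_step :: "nat \<Rightarrow> bit vec \<Rightarrow> bit vec \<Rightarrow> bool" where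
  "flip_step n a b \<longleftrightarrow> (\<exists>s\<in>{1..n}. b = flip_mat n s *\<^sub>v a)"

lemma group_GL_F2: "group (GL_F2 n)"
proof -
  interpret ring "ring_mat TYPE(bit) n ()" by (rule ring_mat)
  show ?thesis by (rule units_group)
qed

lemma flip_mat_GL:
  assumes "n \<ge> 4" "s \<in> {1..n}"
  shows "flip_mat n s \<in> carrier (GL_F2 n)"
  using flip_mat_involutive[OF assms]
  by (auto simp: units_of_carrier Units_def ring_mat_simps intro!: bexI[of _ "flip_mat n s"])

lemma flip_mat_inv:
  assumes "n \<ge> 4" "s \<in> {1..n}"
  shows "inv\<^bsub>GL_F2 n\<^esub> (flip_mat n s) = flip_mat n s"
  using flip_mat_GL[OF assms] flip_mat_involutive[OF assms]
  by (intro group.inv_equality[OF group_GL_F2]) (simp_all add: units_of_mult units_of_one ring_mat_simps)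

lemma flip_group_carrier_mat:
  assumes "n \<ge> 4" "g \<in> carrier (flip_group n)"
  shows "g \<in> carrier_mat n n"
proof -
  have "generate (GL_F2 n) (flip_mat n ` {1..n}) \<subseteq> carrier (GL_F2 n)"
    using flip_mat_GL[OF assms(1)] by (intro group.generate_incl[OF group_GL_F2]) auto
  then show ?thesis
    using assms(2) by (auto simp: flip_group_def units_of_carrier Units_def ring_mat_simps)
qed

lemma flip_group_reaches:
  assumes n: "n \<ge> 4" and g: "g \<in> carrier (flip_group n)"
  shows "a \<in> carrier_vec n \<Longrightarrow> (flip_step n)\<^sup>*\<^sup>* a (g *\<^sub>v a)"
proof -
  have "g \<in> generate (GL_F2 n) (flip_mat n ` {1..n})" using g by (simp add: flip_group_def)
  then show "a \<in> carrier_vec n \<Longrightarrow> (flip_step n)\<^sup>*\<^sup>* a (g *\<^sub>v a)"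
  proof (induction arbitrary: a rule: generate.induct)
    case one
    then show ?case by (simp add: units_of_one ring_mat_simps)
  next
    case (incl h)
    then show ?case by (auto simp: flip_step_def intro!: r_into_rtranclp)
  next
    case (inv h)
    then show ?case using flip_mat_inv[OF n] by (auto simp: flip_step_def intro!: r_into_rtranclp)
  next
    case (eng g h)
    have m: "g \<in> carrier_mat n n" "h \<in> carrier_mat n n"
      using eng flip_group_carrier_mat[OF n] by (simp_all add: flip_group_def)
    then have "h *\<^sub>v a \<in> carrier_vec n" using eng.prems by simp
    with eng have "(flip_step n)\<^sup>*\<^sup>* a (g *\<^sub>v (h *\<^sub>v a))" by (meson rtranclp_trans)
    then show ?case
      using m eng.prems by (simp add: units_of_mult ring_mat_simps assoc_mult_mat_vec[of _ n n _ n])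
  qed
qed

lemma orbit_flip_group:
  assumes n: "n \<ge> 4" and a: "a \<in> carrier_vec n"
  shows "orbit (flip_group n) (flip_action n) a = {b. (flip_step n)\<^sup>*\<^sup>* a b}"
proof (intro equalityI subsetI)
  fix b assume "b \<in> orbit (flip_group n) (flip_action n) a"
  then show "b \<in> {b. (flip_step n)\<^sup>*\<^sup>* a b}"
    using a flip_group_reaches[OF n] by (auto simp: orbit_def flip_action_def)
next
  fix b assume "b \<in> {b. (flip_step n)\<^sup>*\<^sup>* a b}"
  then have "(flip_step n)\<^sup>*\<^sup>* a b" by simp
  then have "\<exists>g\<in>carrier (flip_group n). b = g *\<^sub>v a"
  proof induction
    case base
    have "1\<^sub>m n \<in> carrier (flip_group n)"
      using generate.one[of "GL_F2 n"] by (simp add: flip_group_def units_of_one ring_mat_simps)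
    then show ?case using a by (intro bexI[of _ "1\<^sub>m n"]) auto
  next
    case (step b c)
    then obtain s g where s: "s \<in> {1..n}" "c = flip_mat n s *\<^sub>v b"
      and g: "g \<in> carrier (flip_group n)" "b = g *\<^sub>v a" by (auto simp: flip_step_def)
    have "flip_mat n s * g \<in> carrier (flip_group n)"
      using generate.eng[of "flip_mat n s" "GL_F2 n" "flip_mat n ` {1..n}" g] s g
      by (auto simp: flip_group_def units_of_mult ring_mat_simps generate.incl)
    moreover have "c = (flip_mat n s * g) *\<^sub>v a"
      using s g a flip_group_carrier_mat[OF n g(1)] by (simp add: assoc_mult_mat_vec[of _ n n _ n])
    ultimately show ?case by blast
  qed
  then show "b \<in> orbit (flip_group n) (flip_action n) a"
    using a by (auto simp: orbit_def flip_action_def)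
qed

text \<open>Closure under the generators puts the orbit of \<open>x\<close> inside \<open>T\<close>;
  reachability from the single base point \<open>x\<close> gives the other inclusion.\<close>

lemma flip_orbitI:
  assumes n: "n \<ge> 4" and T: "T \<subseteq> carrier_vec n" "x \<in> T"
    and closed: "\<And>a s. a \<in> T \<Longrightarrow> s \<in> {1..n} \<Longrightarrow> flip_mat n s *\<^sub>v a \<in> T"
    and reach: "\<And>a. a \<in> T \<Longrightarrow> (flip_step n)\<^sup>*\<^sup>* x a"
  shows "T \<in> orbits (flip_group n) (carrier_vec n) (flip_action n)"
proof -
  have "b \<in> T" if "(flip_step n)\<^sup>*\<^sup>* x b" for b
    using that by induction (use T closed in \<open>auto simp: flip_step_def\<close>)
  then have "T = orbit (flip_group n) (flip_action n) x"
    using reach T by (subst orbit_flip_group[OF n]) auto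
  then show ?thesis using T by (auto simp: orbits_def)
qed

section \<open>Reachability between index sets\<close>

definition bar_reach :: "nat \<Rightarrow> nat set \<Rightarrow> nat set \<Rightarrow> bool" where
  "bar_reach n I J \<longleftrightarrow> (flip_step n)\<^sup>*\<^sup>* (bar_sum n I) (bar_sum n J)"

lemma bar_reach_refl [simp]: "bar_reach n I I"
  by (simp add: bar_reach_def)

lemma bar_reach_trans [trans]: "bar_reach n I J \<Longrightarrow> bar_reach n J K \<Longrightarrow> bar_reach n I K"
  unfolding bar_reach_def by (rule rtranclp_trans)

text \<open>Every step is undone by repeating it. Membership in the carrier is carried through the
  induction because involutivity of the action is stated there.\<close>

lemma bar_reach_sym:
  assumes n: "n \<ge> 4" and "bar_reach n I J"
  shows "bar_reach n J I"
proof -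
  have "(flip_step n)\<^sup>*\<^sup>* a b \<Longrightarrow> a \<in> carrier_vec n \<Longrightarrow> b \<in> carrier_vec n \<and> (flip_step n)\<^sup>*\<^sup>* b a" for a b
  proof (induction rule: rtranclp_induct)
    case (step b c)
    then obtain s where s: "s \<in> {1..n}" "c = flip_mat n s *\<^sub>v b" by (auto simp: flip_step_def)
    have "b = flip_mat n s *\<^sub>v c"
      using s step by (simp add: flip_mult_flip[OF n])
    then have "flip_step n c b" using s by (auto simp: flip_step_def)
    moreover have "c \<in> carrier_vec n"
      using s step mult_mat_vec_carrier[OF flip_mat_carrier(1)] by simp
    ultimately show ?case using step by (auto intro: converse_rtranclp_into_rtranclp)
  qed simp
  then show ?thesis using assms(2) by (simp add: bar_reach_def)
qed

lemma bar_reach_transpose: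
  assumes "n \<ge> 4" "1 \<le> s" "s < n" "I \<subseteq> {1..n + 1}"
  shows "bar_reach n I (transpose s (s + 1) ` I)"
  unfolding bar_reach_def flip_bar_sum[OF assms, symmetric]
  using assms by (auto simp: flip_step_def intro!: r_into_rtranclp bexI[of _ s])

lemma initial_segmentI:
  assumes "finite I" "0 \<notin> I" "\<And>s. 1 \<le> s \<Longrightarrow> s + 1 \<in> I \<Longrightarrow> s \<in> I"
  shows "I = {1..card I}"
proof (cases "I = {}")
  case False
  have "j \<in> I" if "1 \<le> j" "j \<le> Max I" for j
    using that(2,1)
  proof (induction j rule: inc_induct)
    case base
    then show ?case using assms(1) False by simp
  next
    case (step j)
    then show ?case using assms(3)[of j] by simp
  qed
  then have "I = {1..Max I}"
    using assms(1,2) by (auto simp: Suc_le_eq intro: gr0I)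
  moreover from this have "card I = Max I" by (metis card_atLeastAtMost diff_Suc_1)
  ultimately show ?thesis by simp
qed simp

text \<open>Bubble sort: as long as \<open>I\<close> has a gap \<open>s\<close> just below an
  element \<open>s + 1\<close>, their transposition lowers the sum of the elements of
  \<open>I\<close>. The set \<open>E\<close> treats vectors inside and outside \<open>Z\<close>
  together, since these transpositions fix \<open>n + 1\<close>.\<close>

lemma bar_reach_initial:
  assumes n: "n \<ge> 4" and E: "E \<subseteq> {n + 1}"
  shows "I \<subseteq> {1..n} \<Longrightarrow> bar_reach n (I \<union> E) ({1..card I} \<union> E)"
proof (induction "\<Sum>I" arbitrary: I rule: less_induct)
  case less
  have fin: "finite I" using less.prems finite_subset by blast
  show ?case
  proof (cases "I = {1..card I}")
    case True
    then show ?thesis by (metis bar_reach_refl)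
  next
    case False
    then obtain s where s: "1 \<le> s" "s + 1 \<in> I" "s \<notin> I"
      using initial_segmentI[OF fin] less.prems by fastforce
    define J where "J = transpose s (s + 1) ` I"
    have sn: "s < n" using s less.prems by auto
    have "\<Sum>J = (\<Sum>i\<in>I. transpose s (s + 1) i)"
      unfolding J_def by (subst sum.reindex) auto
    also have "\<dots> < \<Sum>I"
      by (intro sum_strict_mono_ex1) (use fin s in \<open>auto simp: transpose_def intro!: bexI[of _ "s + 1"]\<close>)
    finally have "\<Sum>J < \<Sum>I" .
    moreover have "J \<subseteq> {1..n}" using less.prems s sn by (auto simp: J_def transpose_def)
    moreover have "card J = card I" unfolding J_def by (intro card_image) auto
    ultimately have "bar_reach n (J \<union> E) ({1..card I} \<union> E)" using less.hyps by metis
    moreover have "transpose s (s + 1) ` (I \<union> E) = J \<union> E"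
      using E sn by (auto simp: J_def transpose_def image_Un)
    then have "bar_reach n (I \<union> E) (J \<union> E)"
      using bar_reach_transpose[OF n s(1) sn, of "I \<union> E"] less.prems E by fastforce
    ultimately show ?thesis by (rule bar_reach_trans[rotated])
  qed
qed

lemma bar_reach_card:
  assumes "n \<ge> 4" "E \<subseteq> {n + 1}" "I \<subseteq> {1..n}" "J \<subseteq> {1..n}" "card I = card J"
  shows "bar_reach n (I \<union> E) (J \<union> E)"
  using bar_reach_initial[OF assms(1-3)] bar_reach_initial[OF assms(1,2,4)]
    bar_reach_sym[OF assms(1)] bar_reach_trans assms(5) by metis

lemma bar_reach_parity:
  assumes n: "n \<ge> 4"
  shows "I \<subseteq> {1..n} \<Longrightarrow> bar_reach n (insert (n + 1) I) (insert (n + 1) (if even (card I) then {} else {1}))"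
proof (induction "card I" arbitrary: I rule: less_induct)
  case less
  have card: "card I \<le> n" using card_mono[OF _ less.prems] by simp
  consider "card I = 0" | "card I = 1" | "card I \<ge> 2" by linarith
  then show ?case
  proof cases
    case 1
    then show ?thesis using bar_reach_initial[OF n, of "{n + 1}" I] less.prems by simp
  next
    case 2
    then show ?thesis using bar_reach_initial[OF n, of "{n + 1}" I] less.prems by (simp add: insert_commute)
  next
    case 3
    \<comment> \<open>Move two elements to \<open>n - 1\<close> and \<open>n\<close> by a permutation; the reflection of vertex \<open>n\<close> deletes them.\<close>
    define K where "K = {1..card I - 2}"
    define J where "J = K \<union> {n - 1, n}"
    \<comment> \<open>Here \<open>card I \<le> n\<close> matters: the initial segment of length
      \<open>card I - 2\<close> ends at \<open>n - 2\<close> at the latest.\<close>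
    have K: "K \<subseteq> {1..n}" "card K = card I - 2" "K \<inter> {n - 1, n} = {}"
      using card 3 n by (auto simp: K_def)
    have J: "J \<subseteq> {1..n}" "card J = card I"
      using K 3 n by (auto simp: J_def card_Un_disjoint K_def)
    \<comment> \<open>Both \<open>n - 1\<close> and \<open>n\<close> lie in \<open>J\<close>, so the
      permutation part of the last generator fixes \<open>J\<close> and only the toggling has an
      effect.\<close>
    have "transpose (n - 1) n ` J = J"
      using K(3) by (auto simp: J_def transpose_def image_iff)
    moreover have "sym_diff J {n - 1, n} = K" using K(3) by (auto simp: J_def)
    ultimately have "bar_reach n (insert (n + 1) J) (insert (n + 1) K)"
      using flip_last_bar_sum_insert[OF n J(1)] n
      by (auto simp: bar_reach_def flip_step_def intro!: r_into_rtranclp bexI[of _ n])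
    moreover have "bar_reach n (insert (n + 1) I) (insert (n + 1) J)"
      using bar_reach_card[OF n, of "{n + 1}" I J] J less.prems by simp
    moreover have "bar_reach n (insert (n + 1) K) (insert (n + 1) (if even (card I) then {} else {1}))"
      using less.hyps[of K] K 3 by simp
    ultimately show ?thesis by (meson bar_reach_trans)
  qed
qed

subsection \<open>Weights and orbits\<close>

text \<open>A dimension count: a basis has \<open>n\<close> elements, as many as there are
  indices.\<close>

lemma inj_bar_vec:
  assumes n: "n \<ge> 4"
  shows "inj_on (bar_vec n) ({1..n - 1} \<union> {n + 1})"
proof -
  interpret vec_space "TYPE(bit)" n .
  have "card (Delta n) = n"
    using dim_basis[OF _ Delta_basis[OF n]] dim_is_n by (simp add: Delta_def)
  moreover have "card ({1..n - 1} \<union> {n + 1}) = n"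
    using n by (subst card_Un_disjoint) auto
  ultimately show ?thesis
    by (intro eq_card_imp_inj_on) (simp_all add: Delta_def)
qed

lemma lincomb_bar:
  assumes n: "n \<ge> 4" and J: "J \<subseteq> {1..n - 1} \<union> {n + 1}"
  shows "LinearCombinations.module.lincomb (module_vec TYPE(bit) n) c (bar_vec n ` J) =
    bar_sum n {i \<in> J. c (bar_vec n i) \<noteq> 0}"
proof -
  interpret vec_space "TYPE(bit)" n .
  have car: "bar_vec n ` J \<subseteq> carrier_vec n" using bar_carrier[OF n] J by force
  have fin: "finite J" using J finite_subset by blast
  show ?thesis
  proof (rule eq_vecI)
    fix k assume "k < dim_vec (bar_sum n {i \<in> J. c (bar_vec n i) \<noteq> 0})"
    then have k: "k < n" by simp
    have "lincomb c (bar_vec n ` J) $ k = (\<Sum>i\<in>J. c (bar_vec n i) * bar_vec n i $ k)"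
      using inj_on_subset[OF inj_bar_vec[OF n] J]
      by (simp add: lincomb_index[OF k car] sum.reindex)
    also have "\<dots> = (\<Sum>i\<in>J. if c (bar_vec n i) \<noteq> 0 then bar_vec n i $ k else 0)"
      by (intro sum.cong) auto
    finally show "lincomb c (bar_vec n ` J) $ k = bar_sum n {i \<in> J. c (bar_vec n i) \<noteq> 0} $ k"
      using k fin by (simp only: bar_sum_index sum.inter_filter)
  qed (use lincomb_dim[OF _ car] fin in simp)
qed

text \<open>Each subset of \<open>J\<close> is the support of a coefficient function, namely the
  indicator of its image; injectivity of \<open>bar_vec n\<close> recovers the subset.\<close>

lemma span_bar:
  assumes n: "n \<ge> 4" and J: "J \<subseteq> {1..n - 1} \<union> {n + 1}"
  shows "LinearCombinations.module.span class_ring (module_vec TYPE(bit) n) (bar_vec n ` J) =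
    bar_sum n ` Pow J"
proof -
  interpret vec_space "TYPE(bit)" n .
  have car: "bar_vec n ` J \<subseteq> carrier_vec n" using bar_carrier[OF n] J by force
  have fin: "finite (bar_vec n ` J)" using J finite_subset by blast
  have "span (bar_vec n ` J) = range (\<lambda>c. bar_sum n {i \<in> J. c (bar_vec n i) \<noteq> (0 :: bit)})"
    using finite_span[OF fin] car unfolding lincomb_bar[OF n J]
    by (auto simp del: bit_not_zero_iff)
  also have "\<dots> = bar_sum n ` Pow J"
  proof (intro equalityI subsetI)
    fix a assume "a \<in> bar_sum n ` Pow J"
    then obtain I where I: "I \<subseteq> J" "a = bar_sum n I" by auto
    have "{i \<in> J. of_bool (bar_vec n i \<in> bar_vec n ` I) \<noteq> (0::bit)} = I"
      using I(1) inj_on_image_mem_iff[OF inj_on_subset[OF inj_bar_vec[OF n] J]] by auto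
    then show "a \<in> range (\<lambda>c. bar_sum n {i \<in> J. c (bar_vec n i) \<noteq> (0 :: bit)})"
      using I(2) by (intro range_eqI[of _ _ "\<lambda>x. of_bool (x \<in> bar_vec n ` I)"]) simp
  qed auto
  finally show ?thesis .
qed

lemma Z_eq: "n \<ge> 4 \<Longrightarrow> Z n = bar_sum n ` Pow {1..n - 1}"
  unfolding Z_def by (rule span_bar) auto

lemma carrier_eq:
  assumes n: "n \<ge> 4"
  shows "carrier_vec n = bar_sum n ` Pow ({1..n - 1} \<union> {n + 1})"
proof -
  interpret vec_space "TYPE(bit)" n .
  have "span (Delta n) = carrier_vec n"
    using Delta_basis[OF n] unfolding basis_def by simp
  then show ?thesis
    using span_bar[OF n subset_refl] unfolding Delta_def by (rule subst[where P = "\<lambda>X. X = _"])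
qed

lemma Delta_coeffs_support:
  assumes n: "n \<ge> 4" and I: "I \<subseteq> {1..n - 1} \<union> {n + 1}"
  shows "{d \<in> Delta n. Delta_coeffs n (bar_sum n I) d \<noteq> 0} = bar_vec n ` I"
proof -
  \<comment> \<open>The indicator is restricted to \<open>Delta n\<close> because the uniqueness
    behind \<open>Delta_coeffs\<close> is among functions that are \<open>undefined\<close>
    elsewhere.\<close>
  define c where "c = (\<lambda>d\<in>Delta n. of_bool (d \<in> bar_vec n ` I) :: bit)"
  have "c (bar_vec n i) = of_bool (i \<in> I)" if "i \<in> {1..n - 1} \<union> {n + 1}" for i
  proof -
    have "bar_vec n i \<in> Delta n" unfolding Delta_def using that by (rule imageI)
    then show ?thesis
      by (simp only: c_def restrict_apply if_True inj_on_image_mem_iff[OF inj_bar_vec[OF n] that I])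
  qed
  then have "{i \<in> {1..n - 1} \<union> {n + 1}. c (bar_vec n i) \<noteq> 0} = {i \<in> {1..n - 1} \<union> {n + 1}. i \<in> I}"
    by (intro Collect_cong conj_cong refl) (simp only: of_bool_eq_0_iff not_not)
  also have "\<dots> = I" using I by blast
  finally have "bar_sum n I = LinearCombinations.module.lincomb (module_vec TYPE(bit) n) c (Delta n)"
    using lincomb_bar[OF n subset_refl, of c] by (simp add: Delta_def)
  then have "Delta_coeffs n (bar_sum n I) = c"
    unfolding Delta_coeffs_def
    by (intro the1_equality Delta_coeffs_unique[OF n] conjI bar_sum_carrier) (simp_all add: c_def)
  moreover have "bar_vec n ` I \<subseteq> Delta n" unfolding Delta_def using I by (rule image_mono)
  ultimately show ?thesis by (auto simp: c_def)
qed

lemma wt_bar_sum: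
  assumes "n \<ge> 4" "I \<subseteq> {1..n - 1} \<union> {n + 1}"
  shows "wt n (bar_sum n I) = card I"
  unfolding wt_def Delta_coeffs_support[OF assms]
  by (rule card_image[OF inj_on_subset[OF inj_bar_vec[OF assms(1)] assms(2)]])

lemma inj_bar_sum:
  assumes n: "n \<ge> 4"
  shows "inj_on (bar_sum n) (Pow ({1..n - 1} \<union> {n + 1}))"
proof (rule inj_onI)
  fix I J
  assume IJ: "I \<in> Pow ({1..n - 1} \<union> {n + 1})" "J \<in> Pow ({1..n - 1} \<union> {n + 1})"
    and eq: "bar_sum n I = bar_sum n J"
  have "bar_vec n ` I = bar_vec n ` J"
    unfolding Delta_coeffs_support[OF n IJ(1)[THEN PowD], symmetric]
      Delta_coeffs_support[OF n IJ(2)[THEN PowD], symmetric] eq ..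
  then show "I = J"
    using inj_on_image_eq_iff[OF inj_bar_vec[OF n]] IJ by blast
qed

text \<open>Weights can be read off only from index sets avoiding \<open>n\<close>, as
  \<open>Delta n\<close> omits that index. A set containing \<open>n\<close> is exchanged for its
  complement, hence the two possible sizes.\<close>

lemma bar_sum_normalise:
  assumes n: "n \<ge> 4" and I: "I \<subseteq> {1..n}"
  obtains J where "J \<subseteq> {1..n - 1}" "bar_sum n J = bar_sum n I" "card J = card I \<or> card J = n - card I"
proof -
  define J where "J = (if n \<in> I then {1..n} - I else I)"
  have "J \<subseteq> {1..n - 1}"
  proof
    fix i assume "i \<in> J"
    then have "1 \<le> i" "i \<le> n" "i \<noteq> n" using I by (auto simp: J_def split: if_splits)
    then show "i \<in> {1..n - 1}" by simp
  qed
  moreover have "bar_sum n J = bar_sum n I" using bar_sum_compl[OF n I] by (simp add: J_def)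
  moreover have "card J = card I \<or> card J = n - card I"
    using I by (simp add: J_def card_Diff_subset finite_subset)
  ultimately show ?thesis by (rule that)
qed

text \<open>Both spaces are images of power sets under an injective map, so the difference can be
  taken before applying the map.\<close>

lemma compl_Z_eq:
  assumes n: "n \<ge> 4"
  shows "carrier_vec n - Z n = (\<lambda>J. bar_sum n (insert (n + 1) J)) ` Pow {1..n - 1}"
proof -
  let ?B = "{1..n - 1} \<union> {n + 1}"
  have "carrier_vec n - Z n = bar_sum n ` (Pow ?B - Pow {1..n - 1})"
    unfolding Z_eq[OF n] carrier_eq[OF n]
    by (rule inj_on_image_set_diff[OF inj_bar_sum[OF n], symmetric]) auto
  also have "Pow ?B - Pow {1..n - 1} = insert (n + 1) ` Pow {1..n - 1}"
    by (auto simp: Pow_insert)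
  finally show ?thesis by (simp add: image_image)
qed

section \<open>The sets of the theorem in terms of index sets\<close>

lemma O_set_eq:
  assumes n: "n \<ge> 4" and i: "i \<le> n"
  shows "O_set n i = bar_sum n ` {I. I \<subseteq> {1..n} \<and> card I = i}"
proof (intro equalityI subsetI)
  fix a assume "a \<in> O_set n i"
  then obtain J where J: "J \<subseteq> {1..n - 1}" "a = bar_sum n J" "wt n a = i \<or> wt n a = n - i"
    by (auto simp: O_set_def Z_eq[OF n])
  have sub: "J \<subseteq> {1..n}" using J(1) by (rule subset_trans) auto
  have wt: "wt n a = card J" unfolding J(2) by (rule wt_bar_sum[OF n]) (use J in auto)
  show "a \<in> bar_sum n ` {I. I \<subseteq> {1..n} \<and> card I = i}"
  proof (cases "card J = i")
    case True
    then show ?thesis using J sub by auto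
  next
    case False
    then have "card ({1..n} - J) = i"
      using J(3) wt i sub by (simp add: card_Diff_subset finite_subset)
    then show ?thesis using J(2) bar_sum_compl[OF n sub] by (intro image_eqI[of _ _ "{1..n} - J"]) auto
  qed
next
  fix a assume "a \<in> bar_sum n ` {I. I \<subseteq> {1..n} \<and> card I = i}"
  then obtain I where I: "I \<subseteq> {1..n}" "card I = i" "a = bar_sum n I" by auto
  from bar_sum_normalise[OF n I(1)] obtain J where
    J: "J \<subseteq> {1..n - 1}" "bar_sum n J = bar_sum n I" "card J = card I \<or> card J = n - card I" .
  have "wt n a = card J" unfolding I(3) J(2)[symmetric] by (rule wt_bar_sum[OF n]) (use J in auto)
  moreover have "a \<in> Z n" unfolding Z_eq[OF n] I(3) J(2)[symmetric] using J(1) by blast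
  ultimately show "a \<in> O_set n i" using I(2) J(3) by (auto simp: O_set_def)
qed

text \<open>
  For odd \<open>n\<close> the parity of \<open>card I\<close> carries no information, because \<open>I\<close> and \<open>{1..n} - I\<close>
  represent the same vector.
\<close>

definition off_Z :: "nat \<Rightarrow> bool \<Rightarrow> bit vec set" where
  "off_Z n p = (\<lambda>I. bar_sum n (insert (n + 1) I)) ` {I. I \<subseteq> {1..n} \<and> (odd n \<or> even (card I) = p)}"

text \<open>The index \<open>n + 1\<close> adds one to the weight, which turns even sizes into odd
  weights. Normalising may replace a size by its difference from \<open>n\<close>, which preserves
  parity when \<open>n\<close> is even.\<close>

lemma off_Z_eq:
  assumes n: "n \<ge> 4"
  shows "off_Z n p = {a \<in> carrier_vec n - Z n. odd n \<or> odd (wt n a) = p}"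
proof -
  have wt: "wt n (bar_sum n (insert (n + 1) J)) = card J + 1" if "J \<subseteq> {1..n - 1}" for J
  proof -
    have "n + 1 \<notin> J" "finite J" using that finite_subset by auto
    moreover have "insert (n + 1) J \<subseteq> {1..n - 1} \<union> {n + 1}" using that by auto
    ultimately show ?thesis using wt_bar_sum[OF n] by simp
  qed
  show ?thesis
  proof (intro equalityI subsetI)
    fix a assume "a \<in> off_Z n p"
    then obtain I where I: "I \<subseteq> {1..n}" "odd n \<or> even (card I) = p" "a = bar_sum n (insert (n + 1) I)"
      by (auto simp: off_Z_def)
    from bar_sum_normalise[OF n I(1)] obtain J where
      J: "J \<subseteq> {1..n - 1}" "bar_sum n J = bar_sum n I" "card J = card I \<or> card J = n - card I" .
    have sub: "J \<subseteq> {1..n}" using J(1) by (rule subset_trans) auto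
    have a: "a = bar_sum n (insert (n + 1) J)"
      using bar_sum_insert[OF n I(1)] bar_sum_insert[OF n sub] J(2) I(3) by simp
    have "card I \<le> n" using card_mono[OF _ I(1)] by simp
    then have "odd n \<or> odd (wt n a) = p" using I(2) J(3) wt[OF J(1)] a by auto
    moreover have "a \<in> carrier_vec n - Z n" unfolding compl_Z_eq[OF n] using a J(1) by blast
    ultimately show "a \<in> {a \<in> carrier_vec n - Z n. odd n \<or> odd (wt n a) = p}" by simp
  next
    fix a assume a: "a \<in> {a \<in> carrier_vec n - Z n. odd n \<or> odd (wt n a) = p}"
    then have "a \<in> carrier_vec n - Z n" by simp
    then obtain J where J: "J \<subseteq> {1..n - 1}" "a = bar_sum n (insert (n + 1) J)"
      unfolding compl_Z_eq[OF n] by blast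
    have "J \<subseteq> {1..n}" using J(1) by (rule subset_trans) auto
    moreover have "odd n \<or> even (card J) = p" using a wt[OF J(1)] J(2) by simp
    ultimately show "a \<in> off_Z n p" unfolding off_Z_def J(2) by (intro imageI) simp
  qed
qed

lemma cong_2_iff_even: "[a = b] (mod 2) \<longleftrightarrow> (even a \<longleftrightarrow> even b)" for a b :: nat
  by (auto simp: cong_def mod2_eq_if)

text \<open>For even \<open>n\<close> the two congruences coincide, for odd \<open>n\<close> they
  cover both parities; the same happens for \<open>Omega_e\<close>.\<close>

lemma Omega_o_eq: "n \<ge> 4 \<Longrightarrow> Omega_o n = off_Z n True"
proof -
  assume n: "n \<ge> 4"
  then have "[w = 1] (mod 2) \<or> [w = n - 1] (mod 2) \<longleftrightarrow> odd n \<or> odd w" for w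
    by (auto simp: cong_2_iff_even)
  then show ?thesis by (simp add: off_Z_eq[OF n] Omega_o_def)
qed

lemma Omega_e_eq: "n \<ge> 4 \<Longrightarrow> Omega_e n = off_Z n False"
proof -
  assume n: "n \<ge> 4"
  then have "[w = 0] (mod 2) \<or> [w = n] (mod 2) \<longleftrightarrow> odd n \<or> even w" for w
    by (auto simp: cong_2_iff_even)
  then show ?thesis by (simp add: off_Z_eq[OF n] Omega_e_def)
qed

section \<open>The orbits inside and outside \<open>Z\<close>\<close>

lemma bar_sum_card_orbit:
  assumes n: "n \<ge> 4" and i: "i \<le> n"
  shows "bar_sum n ` {I. I \<subseteq> {1..n} \<and> card I = i} \<in> orbits (flip_group n) (carrier_vec n) (flip_action n)"
proof (rule flip_orbitI[OF n, of _ "bar_sum n {1..i}"])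
  fix a s assume "a \<in> bar_sum n ` {I. I \<subseteq> {1..n} \<and> card I = i}" and s: "s \<in> {1..n}"
  then obtain I where I: "I \<subseteq> {1..n}" "card I = i" "a = bar_sum n I" by auto
  \<comment> \<open>On these sums every generator, including the last one, is a transposition within
    \<open>{1..n}\<close>, so sizes are kept.\<close>
  obtain t u where tu: "{t, u} \<subseteq> {1..n}" "flip_mat n s *\<^sub>v a = bar_sum n (transpose t u ` I)"
  proof (cases "s = n")
    case True
    then show ?thesis using that[of "n - 1" n] flip_last_bar_sum[OF n I(1)] n I(3) by auto
  next
    case False
    have "I \<subseteq> {1..n + 1}" using I(1) by auto
    then show ?thesis using that[of s "s + 1"] flip_bar_sum[OF n, of s I] s False I(3) by auto
  qed
  have "transpose t u ` I \<subseteq> {1..n}" using tu(1) I(1) by (auto simp: transpose_def)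
  moreover have "card (transpose t u ` I) = i" using I(2) by (subst card_image) auto
  ultimately show "flip_mat n s *\<^sub>v a \<in> bar_sum n ` {I. I \<subseteq> {1..n} \<and> card I = i}"
    unfolding tu(2) by blast
next
  fix a assume "a \<in> bar_sum n ` {I. I \<subseteq> {1..n} \<and> card I = i}"
  then show "(flip_step n)\<^sup>*\<^sup>* (bar_sum n {1..i}) a"
    using bar_reach_card[OF n, of "{}" "{1..i}"] i by (auto simp: bar_reach_def)
qed (use i in auto)

lemma even_card_sym_diff:
  assumes "finite A" "finite B"
  shows "even (card (sym_diff A B)) \<longleftrightarrow> even (card A) = even (card B)"
proof -
  have "card (sym_diff A B) = card (A - B) + card (B - A)"
    using assms by (intro card_Un_disjoint) auto
  moreover have "card A = card (A \<inter> B) + card (A - B)" "card B = card (A \<inter> B) + card (B - A)"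
    using card_Int_Diff[of A B] card_Int_Diff[of B A] assms by (simp_all add: Int_commute)
  ultimately show ?thesis by auto
qed

lemma off_Z_orbit:
  assumes n: "n \<ge> 4"
  shows "off_Z n p \<in> orbits (flip_group n) (carrier_vec n) (flip_action n)"
proof (rule flip_orbitI[OF n, of _ "bar_sum n (insert (n + 1) (if p then {} else {1}))"])
  show "bar_sum n (insert (n + 1) (if p then {} else {1})) \<in> off_Z n p"
    unfolding off_Z_def by (rule imageI) (use n in auto)
next
  fix a s assume "a \<in> off_Z n p" and s: "s \<in> {1..n}"
  then obtain I where I: "I \<subseteq> {1..n}" "odd n \<or> even (card I) = p" "a = bar_sum n (insert (n + 1) I)"
    by (auto simp: off_Z_def)
  have card: "card (transpose t u ` I) = card I" for t u by (rule card_image) simp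
  have fin: "finite I" using I(1) finite_subset by blast
  show "flip_mat n s *\<^sub>v a \<in> off_Z n p"
  proof (cases "s = n")
    case True
    let ?J = "sym_diff (transpose (n - 1) n ` I) {n - 1, n}"
    \<comment> \<open>Toggling two distinct elements keeps the parity.\<close>
    have "even (card ?J) \<longleftrightarrow> even (card I)"
      using n fin by (subst even_card_sym_diff) (simp_all add: card)
    moreover have "?J \<subseteq> {1..n}" using I(1) n by (auto simp: transpose_def)
    ultimately show ?thesis
      using I(2) unfolding I(3) True flip_last_bar_sum_insert[OF n I(1)] off_Z_def by (intro imageI) simp
  next
    case False
    let ?J = "transpose s (s + 1) ` I"
    have "transpose s (s + 1) ` insert (n + 1) I = insert (n + 1) ?J"
      using s False by (simp add: transpose_def)
    moreover have "insert (n + 1) I \<subseteq> {1..n + 1}" using I(1) by auto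
    ultimately have "flip_mat n s *\<^sub>v a = bar_sum n (insert (n + 1) ?J)"
      using flip_bar_sum[OF n, of s "insert (n + 1) I"] s False I(3) by simp
    moreover have "?J \<subseteq> {1..n}" using I(1) s False by (auto simp: transpose_def)
    ultimately show ?thesis using I(2) card[of s "s + 1"] by (auto simp: off_Z_def)
  qed
next
  fix a assume "a \<in> off_Z n p"
  then obtain I where I: "I \<subseteq> {1..n}" "odd n \<or> even (card I) = p" "a = bar_sum n (insert (n + 1) I)"
    by (auto simp: off_Z_def)
  \<comment> \<open>A set of the wrong parity can occur only for odd \<open>n\<close>, and then its
    complement has the right one and represents the same vector.\<close>
  obtain J where J: "J \<subseteq> {1..n}" "even (card J) = p" "a = bar_sum n (insert (n + 1) J)"
  proof (cases "even (card I) = p")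
    case True
    then show ?thesis using I that by blast
  next
    case False
    have "card ({1..n} - I) + card I = n"
      using card_mono[OF _ I(1)] I(1) by (simp add: card_Diff_subset finite_subset)
    then have "even (card ({1..n} - I)) = p" using False I(2) by (metis even_add)
    moreover have "bar_sum n (insert (n + 1) ({1..n} - I)) = bar_sum n (insert (n + 1) I)"
      using bar_sum_insert[OF n I(1)] bar_sum_insert[OF n, of "{1..n} - I"] bar_sum_compl[OF n I(1)] by simp
    ultimately show ?thesis using that[of "{1..n} - I"] I(3) by auto
  qed
  then show "(flip_step n)\<^sup>*\<^sup>* (bar_sum n (insert (n + 1) (if p then {} else {1}))) a"
    using bar_reach_sym[OF n bar_reach_parity[OF n J(1)]] by (simp add: bar_reach_def)
qed (auto simp: off_Z_def)

theorem proposition6p4: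
  fixes n :: nat
  assumes "n \<ge> 4"
  shows "(\<forall>i \<le> n div 2. O_set n i \<in> orbits (flip_group n) (carrier_vec n) (flip_action n)) \<and>
    Omega_o n \<in> orbits (flip_group n) (carrier_vec n) (flip_action n) \<and>
    Omega_e n \<in> orbits (flip_group n) (carrier_vec n) (flip_action n) \<and>
    (odd n \<longrightarrow> Omega_o n = Omega_e n \<and> Omega_e n = carrier_vec n - Z n \<and>
       carrier_vec n - Z n \<in> orbits (flip_group n) (carrier_vec n) (flip_action n))"
proof -
  have "O_set n i \<in> orbits (flip_group n) (carrier_vec n) (flip_action n)" if "i \<le> n div 2" for i
  proof -
    have "i \<le> n" using that by simp
    then show ?thesis unfolding O_set_eq[OF assms \<open>i \<le> n\<close>] by (rule bar_sum_card_orbit[OF assms])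
  qed
  \<comment> \<open>For odd \<open>n\<close> the parity condition is vacuous, so both values of
    \<open>p\<close> give the whole complement of \<open>Z\<close>.\<close>
  moreover have "off_Z n p = carrier_vec n - Z n" if "odd n" for p
    using that by (auto simp: off_Z_eq[OF assms])
  ultimately show ?thesis
    using off_Z_orbit[OF assms] by (metis Omega_o_eq[OF assms] Omega_e_eq[OF assms])
qed

end
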